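(* For any $n \geq 0$, each equivalence class of $\mathfrak{S}_n /_{\equiv_{\mathrm{B}}}$ contains exactly one Baxter permutation.
   Context: $A = \{a_1 < a_2 < \cdots\}$ is a totally ordered infinite alphabet and $A^*$ is the free monoid of words on $A$. The Baxter congruence $\equiv_{\mathrm{B}}$ is the smallest congruence (equivalence relation compatible with concatenation) on $A^*$ such that, for all words $u, v \in A^*$ and letters $a,b,c,d \in A$: $\; c\,u\,a d\,v\,b \equiv_{\mathrm{B}} c\,u\,d a\,v\,b$ whenever $a \leq b < c \leq d$, and $\; b\,u\,d a\,v\,c \equiv_{\mathrm{B}} b\,u\,a d\,v\,c$ whenever $a < b \leq c < d$. $\mathfrak{S}_n$ is the set of permutations of size $n$, a permutation of size $n$ being seen as a word of length $n$ without repetition on the first $n$ letters of $A$ (identified with $1,\dots,n$); $\equiv_{\mathrm{B}}$ thus restricts to an equivalence relation on $\mathfrak{S}_n$. A permutation $\sigma$ is a Baxter permutation if for any subword $u_1u_2u_3u_4$ of $\sigma$ such that the letters $u_2$ and $u_3$ are adjacent in $\sigma$, $\mathrm{std}(u_1u_2u_3u_4) \notin \{2413, 3142\}$, where $\mathrm{std}(u)$ is the unique permutation of size $|u|$ having the same inversions as $u$. *)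

theory Defs
  imports "HOL-Combinatorics.Multiset_Permutations"
begin

text \<open>The letter \<open>a\<^sub>i\<close> of the alphabet \<open>A = {a\<^sub>1 < a\<^sub>2 < \<dots>}\<close> is the positive natural number \<open>i\<close>.\<close>

definition letters :: "nat set" where
  "letters = {1..}"

abbreviation words :: "nat list set" where
  "words \<equiv> lists letters"

inductive_set baxter_cong :: "(nat list \<times> nat list) set" where
  gen1: "\<lbrakk>a \<in> letters; b \<in> letters; c \<in> letters; d \<in> letters; u \<in> words; v \<in> words;
          a \<le> b; b < c; c \<le> d\<rbrakk>
         \<Longrightarrow> ([c] @ u @ [a, d] @ v @ [b], [c] @ u @ [d, a] @ v @ [b]) \<in> baxter_cong"
| gen2: "\<lbrakk>a \<in> letters; b \<in> letters; c \<in> letters; d \<in> letters; u \<in> words; v \<in> words;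
          a < b; b \<le> c; c < d\<rbrakk>
         \<Longrightarrow> ([b] @ u @ [d, a] @ v @ [c], [b] @ u @ [a, d] @ v @ [c]) \<in> baxter_cong"
| refl: "w \<in> words \<Longrightarrow> (w, w) \<in> baxter_cong"
| sym: "(w, w') \<in> baxter_cong \<Longrightarrow> (w', w) \<in> baxter_cong"
| trans: "\<lbrakk>(w, w') \<in> baxter_cong; (w', w'') \<in> baxter_cong\<rbrakk> \<Longrightarrow> (w, w'') \<in> baxter_cong"
| append: "\<lbrakk>(w, w') \<in> baxter_cong; (z, z') \<in> baxter_cong\<rbrakk> \<Longrightarrow> (w @ z, w' @ z') \<in> baxter_cong"

lemma baxter_cong_words: "(w, w') \<in> baxter_cong \<Longrightarrow> w \<in> words \<and> w' \<in> words"
  by (induction rule: baxter_cong.induct) auto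

lemma equiv_baxter_cong: "equiv words baxter_cong"
proof (rule equivI)
  show "baxter_cong \<subseteq> words \<times> words"
    using baxter_cong_words by auto
  show "refl_on words baxter_cong"
    by (auto simp: refl_on_def intro: baxter_cong.refl)
  show "sym baxter_cong"
    by (auto simp: sym_def intro: baxter_cong.sym)
  show "trans baxter_cong"
    by (auto simp: trans_def intro: baxter_cong.trans)
qed

abbreviation perms :: "nat \<Rightarrow> nat list set" where
  "perms n \<equiv> permutations_of_set {1..n}"

definition baxter_cong_perms :: "nat \<Rightarrow> (nat list \<times> nat list) set" where
  "baxter_cong_perms n = baxter_cong \<inter> (perms n \<times> perms n)"

lemma perms_subset_words: "perms n \<subseteq> words"
  by (auto simp: permutations_of_set_def letters_def)

lemma equiv_baxter_cong_perms: "equiv (perms n) (baxter_cong_perms n)"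
proof (rule equivI)
  show "baxter_cong_perms n \<subseteq> perms n \<times> perms n"
    by (auto simp: baxter_cong_perms_def)
  show "refl_on (perms n) (baxter_cong_perms n)"
    using perms_subset_words by (auto simp: refl_on_def baxter_cong_perms_def intro: baxter_cong.refl)
  show "sym (baxter_cong_perms n)"
    by (auto simp: sym_def baxter_cong_perms_def intro: baxter_cong.sym)
  show "trans (baxter_cong_perms n)"
    by (auto simp: trans_def baxter_cong_perms_def intro: baxter_cong.trans)
qed

text \<open>Inversions are pairs of positions, counted from 0.\<close>

definition inversions :: "nat list \<Rightarrow> (nat \<times> nat) set" where
  "inversions u = {(i, j). i < j \<and> j < length u \<and> u ! i > u ! j}"

definition std :: "nat list \<Rightarrow> nat list" where
  "std u = (THE s. s \<in> perms (length u) \<and> inversions s = inversions u)"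

text \<open>In \<open>baxter_permutation\<close> the subword \<open>u\<^sub>1u\<^sub>2u\<^sub>3u\<^sub>4\<close> is given by its positions
  \<open>i < j < k < l\<close>; the equation \<open>k = Suc j\<close> says that \<open>u\<^sub>2\<close> and \<open>u\<^sub>3\<close> are adjacent in \<open>\<sigma>\<close>.\<close>

definition baxter_permutation :: "nat list \<Rightarrow> bool" where
  "baxter_permutation \<sigma> \<longleftrightarrow>
     \<sigma> \<in> perms (length \<sigma>) \<and>
     (\<forall>i j k l. i < j \<and> j < k \<and> k < l \<and> l < length \<sigma> \<and> k = Suc j \<longrightarrow>
        std [\<sigma> ! i, \<sigma> ! j, \<sigma> ! k, \<sigma> ! l] \<notin> {[2, 4, 1, 3], [3, 1, 4, 2]})"

end

theory Submission imports Defs begin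

text \<open>On words without repetition the congruence is generated by exchanging adjacent letters
  \<open>a < d\<close> that have letters of the interval \<open>]a, d[\<close> both on their left and on their right.
  Call \<open>a < d\<close> a violation if no letter of \<open>]a, d[\<close> stands between them, some \<open>x \<in> ]a, d[\<close> is on
  the left of both and some \<open>y \<in> ]a, d[\<close> on the right of both, and their order is the wrong one for
  \<open>x, y\<close>: \<open>a\<close> first although \<open>y < x\<close>, or \<open>d\<close> first although \<open>x < y\<close>. A permutation is Baxter
  iff it has no violation, since on the way from \<open>a\<close> to \<open>d\<close> some two adjacent letters jump over
  the whole interval.

  Uniqueness: if two congruent permutations differ, take a pair \<open>a < d\<close> of minimal width \<open>d - a\<close> on
  whose order they disagree. All narrower pairs being ordered alike, the letters of \<open>]a, d[\<close> lie on
  the same outer sides of \<open>a, d\<close> in both, so \<open>(a, d)\<close> is a violation in one of them.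

  Existence: exchange a violating pair \<open>(a, d)\<close> of minimal width by moving the letters \<open>\<ge> d\<close> of the
  factor between them past the letters \<open>\<le> a\<close>. This affects only pairs whose interval contains
  \<open>[a, d]\<close>. The pair stays a violation only if both \<open>x < y\<close> and \<open>y' < x'\<close> occur among its
  left and right letters, and then there was already a narrower violation. So violations can be
  removed by increasing width.\<close>

section \<open>Relative order of letters in a word\<close>

fun before :: "'a list \<Rightarrow> 'a \<Rightarrow> 'a \<Rightarrow> bool" where
  "before [] x y \<longleftrightarrow> False"
| "before (z # w) x y \<longleftrightarrow> x = z \<and> y \<in> set w \<or> before w x y"

lemma before_append:
  "before (u @ v) x y \<longleftrightarrow> before u x y \<or> before v x y \<or> x \<in> set u \<and> y \<in> set v"
  by (induction u) auto

lemma before_in_set: "before w x y \<Longrightarrow> x \<in> set w \<and> y \<in> set w"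
  by (induction w) auto

lemma before_filter: "before (filter P w) x y \<longleftrightarrow> P x \<and> P y \<and> before w x y"
  by (induction w) (auto dest: before_in_set)

lemma before_rev: "before (rev w) x y \<longleftrightarrow> before w y x"
  by (induction w) (auto simp: before_append dest: before_in_set)

lemma before_total: "x \<in> set w \<Longrightarrow> y \<in> set w \<Longrightarrow> x \<noteq> y \<Longrightarrow> before w x y \<or> before w y x"
  by (induction w) auto

lemma before_asym: "distinct w \<Longrightarrow> before w x y \<Longrightarrow> \<not> before w y x"
  by (induction w) (auto dest: before_in_set)

lemma before_trans: "distinct w \<Longrightarrow> before w x y \<Longrightarrow> before w y z \<Longrightarrow> before w x z"
  by (induction w) (auto dest: before_in_set)

lemma before_split: "before w x y \<Longrightarrow> \<exists>u v t. w = u @ x # v @ y # t"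
proof (induction w)
  case (Cons z w)
  show ?case
  proof (cases "before w x y")
    case True
    then obtain u v t where "w = u @ x # v @ y # t" using Cons.IH by auto
    then have "z # w = (z # u) @ x # v @ y # t" by simp
    then show ?thesis by blast
  next
    case False
    then have "x = z" "y \<in> set w" using Cons.prems by auto
    then obtain v t where "z # w = [] @ x # v @ y # t" by (auto dest: split_list)
    then show ?thesis by blast
  qed
qed simp

lemma first_with_property:
  assumes "distinct w" "x \<in> set w" "P x"
  shows "\<exists>s. s \<in> set w \<and> P s \<and> (\<forall>t. P t \<longrightarrow> \<not> before w t s)"
proof -
  obtain u s v where w: "w = u @ s # v" "P s" "\<forall>t\<in>set u. \<not> P t"
    using split_list_first_prop[of w P] assms by auto
  have "\<not> before w t s" if "P t" for t
    using w that assms(1) by (auto simp: before_append dest: before_in_set)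
  then show ?thesis using w by auto
qed

text \<open>In a word without repetition nothing precedes the first letter, so both words begin
  alike and induction applies to the tails.\<close>

lemma eq_if_before_eq:
  assumes "distinct w" "distinct w'" "set w = set w'"
    and "\<And>x y. before w x y \<Longrightarrow> before w' x y"
  shows "w = w'"
  using assms
proof (induction w arbitrary: w')
  case (Cons z w)
  obtain z' v where w': "w' = z' # v" using Cons.prems(3) by (cases w') auto
  have "z' = z"
  proof (rule ccontr)
    assume ne: "z' \<noteq> z"
    then have "before (z # w) z z'" using Cons.prems(3) w' by auto
    then have "before w' z z'" by (rule Cons.prems(4))
    then show False using ne w' Cons.prems(2) by (auto dest: before_in_set)
  qed
  moreover have "w = v"
  proof (rule Cons.IH)
    show "distinct w" "distinct v" using Cons.prems w' by auto
    show "set w = set v" using Cons.prems(1-3) w' \<open>z' = z\<close> by (simp add: insert_ident)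
    show "before v x y" if "before w x y" for x y
      using that Cons.prems(4)[of x y] Cons.prems(1) w' \<open>z' = z\<close> by (auto dest: before_in_set)
  qed
  ultimately show ?case using w' by simp
qed simp

section \<open>The congruence as exchange of adjacent letters\<close>

definition separated_by :: "nat list \<Rightarrow> nat \<Rightarrow> nat \<Rightarrow> nat \<Rightarrow> nat \<Rightarrow> bool" where
  "separated_by w a d x y \<longleftrightarrow> a < x \<and> x < d \<and> a < y \<and> y < d \<and>
     before w x a \<and> before w x d \<and> before w a y \<and> before w d y"

lemma separated_by_in_set:
  "separated_by w a d x y \<Longrightarrow> a \<in> set w \<and> d \<in> set w \<and> x \<in> set w \<and> y \<in> set w"
  using before_in_set by (metis separated_by_def)

text \<open>One rule covers both generators in both directions: \<open>min\<close> and
  \<open>max\<close> leave open which of \<open>p\<close>, \<open>q\<close> is larger, and the order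
  of \<open>x\<close> and \<open>y\<close> decides which generator applies. Since \<open>x\<close>
  and \<open>y\<close> may stand anywhere in \<open>u\<close> and \<open>v\<close>, contexts need no
  rule of their own.\<close>

inductive swap :: "nat list \<Rightarrow> nat list \<Rightarrow> bool" where
  "x \<in> set u \<Longrightarrow> y \<in> set v \<Longrightarrow> min p q < x \<Longrightarrow> x < max p q \<Longrightarrow> min p q < y \<Longrightarrow> y < max p q
    \<Longrightarrow> swap (u @ [p, q] @ v) (u @ [q, p] @ v)"

lemma swap_append:
  assumes "swap w w'"
  shows "swap (s @ w @ t) (s @ w' @ t)"
  using assms
proof cases
  case (1 x u y v p q)
  then show ?thesis using swap.intros[of x "s @ u" y "v @ t" p q] by simp
qed

lemma swap_mset: "swap w w' \<Longrightarrow> mset w = mset w'"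
  by (induction rule: swap.induct) simp

lemma swap_sym: "swap w w' \<Longrightarrow> swap w' w"
  by (induction rule: swap.induct) (metis swap.intros min.commute max.commute)

lemma swap_rtranclp_append:
  "swap\<^sup>*\<^sup>* w w' \<Longrightarrow> swap\<^sup>*\<^sup>* (s @ w @ t) (s @ w' @ t)"
  by (induction rule: rtranclp_induct) (auto intro: rtranclp.rtrancl_into_rtrancl swap_append)

lemma swap_rtranclp_mset: "swap\<^sup>*\<^sup>* w w' \<Longrightarrow> mset w = mset w'"
  by (induction rule: rtranclp_induct) (auto dest: swap_mset)

lemma swap_rtranclp_set: "swap\<^sup>*\<^sup>* w w' \<Longrightarrow> set w' = set w"
  by (rule mset_eq_setD, rule HOL.sym, rule swap_rtranclp_mset)

lemma swap_rtranclp_distinct: "swap\<^sup>*\<^sup>* w w' \<Longrightarrow> distinct w \<Longrightarrow> distinct w'"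
  using swap_rtranclp_mset[of w w'] mset_eq_imp_distinct_iff[of w w'] by blast

lemma baxter_cong_mset: "(w, w') \<in> baxter_cong \<Longrightarrow> mset w = mset w'"
  by (induction rule: baxter_cong.induct) auto

text \<open>Distinctness makes the weak inequalities of \<open>gen1\<close> strict, as
  \<open>swap\<close> demands. It passes through \<open>sym\<close> and \<open>trans\<close> because
  congruent words have the same multiset of letters.\<close>

lemma baxter_cong_imp_swaps:
  "(w, w') \<in> baxter_cong \<Longrightarrow> distinct w \<Longrightarrow> swap\<^sup>*\<^sup>* w w'"
proof (induction rule: baxter_cong.induct)
  case (gen1 a b c d u v)
  then have "swap (([c] @ u) @ [a, d] @ v @ [b]) (([c] @ u) @ [d, a] @ v @ [b])"
    by (intro swap.intros[of c _ b]) auto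
  then show ?case by auto
next
  case (gen2 a b c d u v)
  then have "swap (([b] @ u) @ [d, a] @ v @ [c]) (([b] @ u) @ [a, d] @ v @ [c])"
    by (intro swap.intros[of b _ c]) auto
  then show ?case by auto
next
  case (sym w w')
  then have "swap\<^sup>*\<^sup>* w w'"
    using baxter_cong_mset mset_eq_imp_distinct_iff by blast
  then show ?case
    by (induction rule: rtranclp_induct) (auto intro: converse_rtranclp_into_rtranclp swap_sym)
next
  case (trans w w' w'')
  then show ?case
    using baxter_cong_mset mset_eq_imp_distinct_iff by (metis rtranclp_trans)
next
  case (append w w' z z')
  then have "swap\<^sup>*\<^sup>* ([] @ w @ z) ([] @ w' @ z)" "swap\<^sup>*\<^sup>* (w' @ z @ []) (w' @ z' @ [])"
    by (intro swap_rtranclp_append; simp)+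
  then show ?case by simp
qed auto

text \<open>The factor from \<open>x\<close> to \<open>y\<close> is an instance of
  \<open>gen1\<close> if \<open>y < x\<close> and of \<open>gen2\<close> read backwards otherwise;
  the remaining letters are context.\<close>

lemma swap_imp_baxter_cong:
  assumes "swap w w'" "w \<in> words"
  shows "(w, w') \<in> baxter_cong"
proof -
  have ordered: "(u @ [p, q] @ v, u @ [q, p] @ v) \<in> baxter_cong"
    if xy: "x \<in> set u" "y \<in> set v" "p < x" "x < q" "p < y" "y < q"
      and words: "u @ [p, q] @ v \<in> words" for x u y v p q
  proof -
    obtain u1 u2 where u: "u = u1 @ x # u2" using xy(1) by (auto dest: split_list)
    obtain v1 v2 where v: "v = v1 @ y # v2" using xy(2) by (auto dest: split_list)
    have "([x] @ u2 @ [p, q] @ v1 @ [y], [x] @ u2 @ [q, p] @ v1 @ [y]) \<in> baxter_cong"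
    proof (cases "y < x")
      case True
      then show ?thesis using xy words u v by (intro baxter_cong.gen1) auto
    next
      case False
      then show ?thesis
        using xy words u v by (intro baxter_cong.sym[OF baxter_cong.gen2]) auto
    qed
    then have "(u1 @ ([x] @ u2 @ [p, q] @ v1 @ [y]) @ v2, u1 @ ([x] @ u2 @ [q, p] @ v1 @ [y]) @ v2)
        \<in> baxter_cong"
      using words u v
      by (intro baxter_cong.append[OF baxter_cong.refl[of u1]] baxter_cong.append[OF _ baxter_cong.refl[of v2]])
        auto
    then show ?thesis by (simp add: u v)
  qed
  from assms(1) show ?thesis
  proof cases
    case (1 x u y v p q)
    show ?thesis
    proof (cases "p < q")
      case True
      then show ?thesis using ordered[of x u y v p q] 1 assms(2) by (simp add: min_def max_def)
    next
      case False
      then show ?thesis using ordered[of x u y v q p, THEN baxter_cong.sym] 1 assms(2)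
        by (auto simp: min_def max_def split: if_splits)
    qed
  qed
qed

lemma swaps_imp_baxter_cong:
  "swap\<^sup>*\<^sup>* w w' \<Longrightarrow> w \<in> words \<Longrightarrow> (w, w') \<in> baxter_cong"
proof (induction rule: rtranclp_induct)
  case (step y z)
  then show ?case
    by (meson baxter_cong.trans baxter_cong_words swap_imp_baxter_cong)
qed (auto intro: baxter_cong.refl)

section \<open>Separating letters along a sequence of exchanges\<close>

text \<open>Only the exchanged pair changes its order, and the two letters that license the exchange
  are the witnesses.\<close>

lemma swap_before:
  assumes "swap w w'" "distinct w" "before w x y" "\<not> before w' x y"
  shows "\<exists>l r. separated_by w (min x y) (max x y) l r"
  using assms
proof cases
  case (1 l u r v p q)
  then have "x = p" "y = q"
    using assms(2-4) by (auto simp: before_append)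
  then show ?thesis using 1 assms(2)
    by (intro exI[of _ l] exI[of _ r])
      (auto simp: separated_by_def before_append min_def max_def)
qed

text \<open>A witness loses its place only when it is itself exchanged with \<open>a\<close> or
  \<open>d\<close>. The licensing letter on the same side then replaces it: it lies between the
  exchanged letters in value, hence in \<open>]a, d[\<close>, and further out in the word.\<close>

lemma swap_separated:
  assumes "swap w w'" "distinct w" "separated_by w a d x y"
  shows "\<exists>x y. separated_by w' a d x y"
  using assms(1)
proof cases
  case (1 l u r v p q)
  have keep: "before w' x y" if "before w x y" "(x, y) \<noteq> (p, q)" for x y
    using that 1 by (auto simp: before_append)
  have lr: "before w' l p" "before w' l q" "before w' p r" "before w' q r"
    "before w l p" "before w p r" "before w q r" "before w p q" "l \<noteq> p" "r \<noteq> q"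
    using 1 by (auto simp: before_append)
  note tr = before_trans[OF assms(2)]
  note sep = assms(3)[unfolded separated_by_def]
  have "\<exists>x. a < x \<and> x < d \<and> before w' x a \<and> before w' x d"
  proof (cases "x = p \<and> (a = q \<or> d = q)")
    case True
    then have "before w l a" "before w l d" "a < l" "l < d"
      using True tr[OF lr(5), of a] tr[OF lr(5), of d] sep 1 by (auto simp: min_def max_def split: if_splits)
    then show ?thesis using keep[of l a] keep[of l d] lr(9) by blast
  next
    case False
    then show ?thesis using keep[of x a] keep[of x d] sep by blast
  qed
  moreover have "\<exists>y. a < y \<and> y < d \<and> before w' a y \<and> before w' d y"
  proof (cases "y = q \<and> (a = p \<or> d = p)")
    case True
    then have "before w a r" "before w d r" "a < r" "r < d"
      using True tr[OF _ lr(7), of a] tr[OF _ lr(7), of d] sep 1 by (auto simp: min_def max_def split: if_splits)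
    then show ?thesis using keep[of a r] keep[of d r] lr(10) by blast
  next
    case False
    then show ?thesis using keep[of a y] keep[of d y] sep by blast
  qed
  ultimately show ?thesis unfolding separated_by_def by blast
qed

text \<open>The exchange that reverses \<open>x\<close> and \<open>y\<close> supplies witnesses, and
  all later exchanges preserve their existence.\<close>

lemma discordant_separated:
  assumes "swap\<^sup>*\<^sup>* w w'" "distinct w" "before w x y" "\<not> before w' x y"
  shows "\<exists>l r. separated_by w' (min x y) (max x y) l r"
  using assms(1,4)
proof (induction rule: rtranclp_induct)
  case base
  then show ?case using assms(3) by simp
next
  case (step v z)
  have "distinct v"
    using swap_rtranclp_distinct[OF step.hyps(1) assms(2)] .
  then have "\<exists>l r. separated_by v (min x y) (max x y) l r"
    using step swap_before by blast
  then show ?case using swap_separated[OF step.hyps(2) \<open>distinct v\<close>] by blast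
qed

section \<open>Violations and adjacent patterns\<close>

text \<open>The condition does not mention the order of \<open>a\<close> and \<open>d\<close>
  themselves, so it can be carried over between words that disagree on this pair only.\<close>

definition unseparated :: "nat list \<Rightarrow> nat \<Rightarrow> nat \<Rightarrow> bool" where
  "unseparated w a d \<longleftrightarrow> (\<forall>m\<in>set w. a < m \<and> m < d \<longrightarrow>
     before w m a \<and> before w m d \<or> before w a m \<and> before w d m)"

definition violation :: "nat list \<Rightarrow> nat \<Rightarrow> nat \<Rightarrow> bool" where
  "violation w a d \<longleftrightarrow> unseparated w a d \<and>
     (\<exists>x y. separated_by w a d x y \<and> (before w a d \<and> y < x \<or> before w d a \<and> x < y))"

text \<open>A discrete intermediate value argument: a walk from a letter with \<open>P\<close> to
  one without it has a step that leaves \<open>P\<close>.\<close>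

lemma adjacent_crossing:
  assumes "P x" "\<not> P y"
  shows "\<exists>u p q v. x # m @ [y] = u @ [p, q] @ v \<and> P p \<and> \<not> P q"
  using assms(1)
proof (induction m arbitrary: x)
  case Nil
  then show ?case using assms(2) by (intro exI[of _ "[]"] exI[of _ x] exI[of _ y]) auto
next
  case (Cons z m)
  show ?case
  proof (cases "P z")
    case True
    then obtain u p q v where "z # m @ [y] = u @ [p, q] @ v" "P p" "\<not> P q"
      using Cons.IH by blast
    then have "x # (z # m) @ [y] = (x # u) @ [p, q] @ v \<and> P p \<and> \<not> P q" by simp
    then show ?thesis by blast
  next
    case False
    then have "x # (z # m) @ [y] = [] @ [x, z] @ (m @ [y]) \<and> P x \<and> \<not> P z"
      using Cons.prems by simp
    then show ?thesis by blast
  qed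
qed

text \<open>The factor form of the forbidden patterns: the first alternative is 3142, the second
  2413, with \<open>p\<close> and \<open>q\<close> as the adjacent middle letters.\<close>

definition adjacent_pattern :: "nat list \<Rightarrow> bool" where
  "adjacent_pattern w \<longleftrightarrow> (\<exists>u x p q v y. w = u @ [p, q] @ v \<and> x \<in> set u \<and> y \<in> set v \<and>
     (p < y \<and> y < x \<and> x < q \<or> q < x \<and> x < y \<and> y < p))"

text \<open>Here \<open>s\<close>, \<open>b\<close> are \<open>a\<close>, \<open>d\<close> in their
  order in the word, so that one splitting serves both kinds of violation.\<close>

lemma unseparated_split:
  assumes "distinct w" "unseparated w a d" "separated_by w a d x y"
    and "before w s b" "{s, b} = {a, d}"
  obtains u m v where "w = u @ (s # m @ [b]) @ v" "x \<in> set u" "y \<in> set v"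
    "\<And>z. z \<in> set (s # m @ [b]) \<Longrightarrow> z \<le> a \<or> d \<le> z"
proof -
  obtain u m v where w: "w = u @ s # m @ b # v" using before_split[OF assms(4)] by blast
  have x: "before w x s" "before w s y" "before w x b" "before w b y"
    using assms(3,5) by (auto simp: separated_by_def doubleton_eq_iff)
  show thesis
  proof
    show "w = u @ (s # m @ [b]) @ v" using w by simp
    show "x \<in> set u"
      using x(1) assms(1) w by (auto simp: before_append dest: before_in_set)
    show "y \<in> set v"
      using x(4) assms(1) w by (auto simp: before_append dest: before_in_set)
    show "z \<le> a \<or> d \<le> z" if "z \<in> set (s # m @ [b])" for z
    proof (rule ccontr)
      assume "\<not> (z \<le> a \<or> d \<le> z)"
      then have z: "a < z" "z < d" "z \<in> set m" using that assms(5) by (auto simp: doubleton_eq_iff)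
      then have "before w s z" "before w z b" using w by (auto simp: before_append)
      moreover have "before w z s \<and> before w z b \<or> before w s z \<and> before w b z"
        using assms(2,5) z w by (auto simp: unseparated_def doubleton_eq_iff)
      ultimately show False using before_asym[OF assms(1)] by blast
    qed
  qed
qed

lemma violation_imp_adjacent_pattern:
  assumes "distinct w" "violation w a d"
  shows "adjacent_pattern w"
proof -
  obtain x y where xy: "separated_by w a d x y"
    and or: "before w a d \<and> y < x \<or> before w d a \<and> x < y" and un: "unseparated w a d"
    using assms(2) unfolding violation_def by blast
  have ad: "a < x" "x < d" "a < y" "y < d" using xy by (auto simp: separated_by_def)
  from or show ?thesis
  proof (elim disjE conjE)
    assume "before w a d" "y < x"
    obtain u m v where w: "w = u @ (a # m @ [d]) @ v" "x \<in> set u" "y \<in> set v"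
      and z: "\<And>z. z \<in> set (a # m @ [d]) \<Longrightarrow> z \<le> a \<or> d \<le> z"
      by (rule unseparated_split[OF assms(1) un xy \<open>before w a d\<close> HOL.refl]) (rule that)
    obtain u' p q v' where c: "a # m @ [d] = u' @ [p, q] @ v'" "p \<le> a" "\<not> q \<le> a"
      using adjacent_crossing[of "\<lambda>z. z \<le> a" a d m] ad by auto
    have "d \<le> q" using z[of q] c by auto
    then have "w = (u @ u') @ [p, q] @ (v' @ v)" "p < y" "x < q" using w c ad by auto
    then show ?thesis unfolding adjacent_pattern_def using w(2,3) \<open>y < x\<close> ad
      by (intro exI[of _ "u @ u'"] exI[of _ x] exI[of _ p] exI[of _ q] exI[of _ "v' @ v"] exI[of _ y]) auto
  next
    assume "before w d a" "x < y"
    obtain u m v where w: "w = u @ (d # m @ [a]) @ v" "x \<in> set u" "y \<in> set v"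
      and z: "\<And>z. z \<in> set (d # m @ [a]) \<Longrightarrow> z \<le> a \<or> d \<le> z"
      by (rule unseparated_split[OF assms(1) un xy \<open>before w d a\<close> insert_commute]) (rule that)
    obtain u' p q v' where c: "d # m @ [a] = u' @ [p, q] @ v'" "d \<le> p" "\<not> d \<le> q"
      using adjacent_crossing[of "\<lambda>z. d \<le> z" d a m] ad by auto
    have "q \<le> a" using z[of q] c by auto
    then have "w = (u @ u') @ [p, q] @ (v' @ v)" "q < x" "y < p" using w c ad by auto
    then show ?thesis unfolding adjacent_pattern_def using w(2,3) \<open>x < y\<close> ad
      by (intro exI[of _ "u @ u'"] exI[of _ x] exI[of _ p] exI[of _ q] exI[of _ "v' @ v"] exI[of _ y]) auto
  qed
qed

text \<open>The pair \<open>p\<close>, \<open>q\<close> is itself a violation: nothing stands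
  between adjacent letters.\<close>

lemma adjacent_pattern_imp_violation:
  assumes "distinct w" "adjacent_pattern w"
  shows "\<exists>a d. violation w a d"
proof -
  obtain u x p q v y where w: "w = u @ [p, q] @ v" "x \<in> set u" "y \<in> set v"
    and or: "p < y \<and> y < x \<and> x < q \<or> q < x \<and> x < y \<and> y < p"
    using assms(2) unfolding adjacent_pattern_def by blast
  have "separated_by w (min p q) (max p q) x y"
    using w or by (auto simp: separated_by_def before_append min_def max_def)
  moreover have "unseparated w (min p q) (max p q)"
    using w by (auto simp: unseparated_def before_append min_def max_def)
  moreover have "before w p q" using w by (auto simp: before_append)
  moreover have "p < q \<and> y < x \<or> q < p \<and> x < y" using or by auto
  ultimately have "violation w (min p q) (max p q)"
    unfolding violation_def by (metis max.absorb3 max.absorb4 min.absorb3 min.absorb4)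
  then show ?thesis by blast
qed

section \<open>Uniqueness in a congruence class\<close>

lemma unique_without_violation:
  assumes "swap\<^sup>*\<^sup>* w w'" "distinct w" "\<nexists>a d. violation w a d" "\<nexists>a d. violation w' a d"
  shows "w = w'"
proof -
  have ms: "distinct w'" "set w = set w'"
    using swap_rtranclp_set[OF assms(1)] swap_rtranclp_distinct[OF assms(1,2)] by auto
  note as = before_asym[OF assms(2)] before_asym[OF ms(1)]
  have conc: "before w a d = before w' a d \<and> before w d a = before w' d a" if "a < d" for a d
    using that
  proof (induction "d - a" arbitrary: a d rule: less_induct)
    case less
    \<comment> \<open>Every other pair with both letters in \<open>[a, d]\<close> is narrower, or
      consists of one repeated letter, which never precedes itself.\<close>
    have IH: "before w b c = before w' b c" if "a \<le> b" "a \<le> c" "b \<le> d" "c \<le> d" "{b, c} \<noteq> {a, d}" for b c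
    proof -
      have "c - b < d - a" if "b < c"
      proof -
        have "a < b \<or> c < d" using \<open>a \<le> b\<close> \<open>c \<le> d\<close> \<open>{b, c} \<noteq> {a, d}\<close> by auto
        then show ?thesis using that \<open>a \<le> b\<close> \<open>c \<le> d\<close> by arith
      qed
      moreover have "b - c < d - a" if "c < b"
      proof -
        have "a < c \<or> b < d" using \<open>a \<le> c\<close> \<open>b \<le> d\<close> \<open>{b, c} \<noteq> {a, d}\<close> by auto
        then show ?thesis using that \<open>a \<le> c\<close> \<open>b \<le> d\<close> by arith
      qed
      moreover have "b = c \<Longrightarrow> ?thesis" using as(1)[of b b] as(2)[of b b] by blast
      ultimately show ?thesis using less.hyps[of c b] less.hyps[of b c] by (metis linorder_cases)
    qed
    show ?case
    proof (rule ccontr)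
      assume neq: "\<not> ?case"
      have "a \<in> set w" "d \<in> set w"
        using neq before_in_set[of w a d] before_in_set[of w d a] before_in_set[of w' a d]
          before_in_set[of w' d a] ms(2) by auto
      then have cases: "before w a d \<and> before w' d a \<and> \<not> before w' a d \<or>
          before w d a \<and> before w' a d \<and> \<not> before w' d a"
        using neq as(1)[of a d] as(2)[of a d] before_total[of a w d] before_total[of a w' d]
          less.prems ms(2) by auto
      then have "\<exists>x y. separated_by w' (min a d) (max a d) x y"
        using discordant_separated[OF assms(1,2), of a d] discordant_separated[OF assms(1,2), of d a]
        by (auto simp: min.commute max.commute)
      then obtain x y where sep': "separated_by w' a d x y"
        using less.prems by auto
      have sep: "separated_by w a d x y"
        using sep' less.prems IH unfolding separated_by_def by (auto simp: doubleton_eq_iff)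
      \<comment> \<open>A letter between \<open>a\<close> and \<open>d\<close> in one word would, by
        agreement on the narrower pairs, stand between them in the other word too and force the same
        order of \<open>a\<close> and \<open>d\<close> there.\<close>
      have mid: "before w m a \<and> before w m d \<and> before w' m a \<and> before w' m d \<or>
          before w a m \<and> before w d m \<and> before w' a m \<and> before w' d m"
        if m: "m \<in> set w" "a < m" "m < d" for m
      proof -
        have eq: "before w m a = before w' m a" "before w a m = before w' a m"
          "before w m d = before w' m d" "before w d m = before w' d m"
          using m IH[of m a] IH[of a m] IH[of m d] IH[of d m] by (auto simp: doubleton_eq_iff)
        have "before w m a \<or> before w a m" "before w m d \<or> before w d m"
          using \<open>a \<in> set w\<close> \<open>d \<in> set w\<close> m before_total[of m w a] before_total[of m w d] by auto
        then show ?thesis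
          using eq cases as(2)[of a d] before_trans[OF ms(1), of a m d] before_trans[OF ms(1), of d m a]
            as(1)[of a d] before_trans[OF assms(2), of a m d] before_trans[OF assms(2), of d m a]
          by auto
      qed
      have un: "unseparated w a d"
        unfolding unseparated_def by (intro ballI impI, elim conjE, drule (2) mid) argo
      have un': "unseparated w' a d"
        unfolding unseparated_def ms(2)[symmetric]
        by (intro ballI impI, elim conjE, drule (2) mid) argo
      have "x \<noteq> y" using sep as(1)[of x a] unfolding separated_by_def by auto
      then show False
      \<comment> \<open>The two words order \<open>a\<close>, \<open>d\<close> oppositely but share
        the witnesses \<open>x\<close>, \<open>y\<close>, so exactly one of the two orders is the
        wrong one.\<close>
      proof (cases "x < y \<longleftrightarrow> before w d a")
        case True
        then have "violation w a d"
          unfolding violation_def using cases un sep \<open>x \<noteq> y\<close> linorder_neqE_nat by metis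
        then show False using assms(3) by blast
      next
        case False
        then have "violation w' a d"
          unfolding violation_def using cases un' sep' \<open>x \<noteq> y\<close> as(1)[of a d] linorder_neqE_nat
          by metis
        then show False using assms(4) by blast
      qed
    qed
  qed
  show ?thesis
  proof (rule eq_if_before_eq[OF assms(2) ms])
    show "before w' x y" if "before w x y" for x y
    proof (cases x y rule: linorder_cases)
      case less
      then show ?thesis using that conc[of x y] by simp
    next
      case equal
      then show ?thesis using that as(1)[of x x] by simp
    next
      case greater
      then show ?thesis using that conc[of y x] by simp
    qed
  qed
qed

section \<open>Narrower violations inside an ambiguous pair\<close>

lemma separated_by_rev: "separated_by (rev w) a d x y \<longleftrightarrow> separated_by w a d y x"
  by (auto simp: separated_by_def before_rev)

lemma unseparated_rev: "unseparated (rev w) a d \<longleftrightarrow> unseparated w a d"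
  by (auto simp: unseparated_def before_rev)

text \<open>Reversal exchanges the two witnesses as well as the order of \<open>a\<close> and
  \<open>d\<close>, so the two kinds of violation are interchanged.\<close>

lemma violation_rev: "violation (rev w) a d \<longleftrightarrow> violation w a d"
  by (auto simp: violation_def separated_by_rev unseparated_rev before_rev)

text \<open>Taking \<open>x\<close> and \<open>z\<close> as close as possible puts every letter of \<open>]x, z[\<close> on the right of
  \<open>a\<close> and \<open>d\<close>. The violation consists of whichever of \<open>x, z\<close> comes second in the word, and of the
  first letter after it that lies in \<open>[a, d]\<close> on the far side of the other one.\<close>

lemma smaller_violation_if_alternating:
  assumes dist: "distinct w" and un: "unseparated w a d"
    and "separated_by w a d x y" "separated_by w a d z y" "x < y" "y < z"
  shows "\<exists>a' d'. violation w a' d' \<and> d' - a' < d - a"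
  using assms(3-)
proof (induction "z - x" arbitrary: x z rule: less_induct)
  case less
  note tr = before_trans[OF dist] and as = before_asym[OF dist]
  note sep = less.prems(1,2)[unfolded separated_by_def]
  have in_set: "a \<in> set w" "d \<in> set w" "x \<in> set w" "z \<in> set w"
    using less.prems separated_by_in_set by blast+
  show ?case
  proof (cases "\<exists>m\<in>set w. x < m \<and> m < z \<and> before w m a \<and> before w m d")
    case True
    \<comment> \<open>Such an \<open>m\<close> replaces \<open>x\<close> or \<open>z\<close>,
      whichever lies on the same side of \<open>y\<close>, and brings the two left letters closer
      together.\<close>
    then obtain m where m: "x < m" "m < z" "before w m a" "before w m d" by blast
    then have "separated_by w a d m y" using sep unfolding separated_by_def by auto
    moreover have "m \<noteq> y" using m as[of m a] sep by auto
    ultimately show ?thesis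
      using less.hyps[of z m] less.hyps[of m x] less.prems m by (cases "m < y") auto
  next
    case False
    have mid: "before w a m \<and> before w d m" if "m \<in> set w" "x < m" "m < z" for m
      using un False that sep unfolding unseparated_def by (meson less_trans)
    have "before w x z \<or> before w z x"
      using before_total[of x w z] in_set less.prems by auto
    then show ?thesis
    proof
      assume xz: "before w x z"
      obtain s where s: "s \<in> set w" "a \<le> s" "s < x" "before w z s"
        and first: "\<And>t. a \<le> t \<Longrightarrow> t < x \<Longrightarrow> before w z t \<Longrightarrow> \<not> before w t s"
        \<comment> \<open>The letter \<open>a\<close> itself qualifies, so a first such letter
          exists.\<close>
        using first_with_property[OF dist in_set(1), of "\<lambda>t. a \<le> t \<and> t < x \<and> before w z t"] sep
        by auto
      have "s = a \<or> before w s a"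
        using first[of a] before_total[of s w a] s in_set sep by auto
      then have sm: "before w s m" if "before w a m" for m
        using that tr[of s a m] by auto
      have zm: "before w z m" if "before w a m" for m
        using that tr[of z a m] sep by auto
      have "unseparated w s z"
        unfolding unseparated_def
      proof (intro ballI impI)
        fix m assume m: "m \<in> set w" "s < m \<and> m < z"
        \<comment> \<open>Letters below \<open>x\<close> that follow \<open>z\<close> also follow
          \<open>s\<close>, by the choice of \<open>s\<close>; those preceding \<open>z\<close>
          precede both. The letter \<open>x\<close> precedes \<open>z\<close>, and letters above
          \<open>x\<close> stand to the right of \<open>a\<close>.\<close>
        consider "m < x" "before w z m" | "m < x" "before w m z" | "m = x" | "x < m"
          using before_total[of m w z] m in_set by fastforce
        then show "before w m s \<and> before w m z \<or> before w s m \<and> before w z m"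
        proof cases
          case 1
          then show ?thesis using first[of m] before_total[of s w m] s m by auto
        next
          case 2
          then show ?thesis using tr[of m z s] s by auto
        next
          case 3
          then show ?thesis using tr[of x z s] s xz by auto
        next
          case 4
          then show ?thesis using mid[of m] m sm[of m] zm[of m] by auto
        qed
      qed
      moreover have "separated_by w s z x y"
        unfolding separated_by_def using s less.prems xz tr[of x z s] sm[of y] zm[of y] sep by auto
      ultimately have "violation w s z" unfolding violation_def using s less.prems by blast
      moreover have "z - s < d - a" using s sep by linarith
      ultimately show ?thesis by blast
    next
      assume zx: "before w z x"
      \<comment> \<open>The same argument with the order of the alphabet reversed: \<open>d\<close>
        now guarantees existence, and the violation is \<open>(x, b)\<close>.\<close>
      obtain b where b: "b \<in> set w" "z < b" "b \<le> d" "before w x b"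
        and first: "\<And>t. z < t \<Longrightarrow> t \<le> d \<Longrightarrow> before w x t \<Longrightarrow> \<not> before w t b"
        using first_with_property[OF dist in_set(2), of "\<lambda>t. z < t \<and> t \<le> d \<and> before w x t"] sep
        by auto
      have "b = d \<or> before w b d"
        using first[of d] before_total[of b w d] b in_set sep by auto
      then have bm: "before w b m" if "before w d m" for m
        using that tr[of b d m] by auto
      have xm: "before w x m" if "before w a m" for m
        using that tr[of x a m] sep by auto
      have "unseparated w x b"
        unfolding unseparated_def
      proof (intro ballI impI)
        fix m assume m: "m \<in> set w" "x < m \<and> m < b"
        consider "z < m" "before w x m" | "z < m" "before w m x" | "m = z" | "m < z"
          using before_total[of m w x] m in_set by fastforce
        then show "before w m x \<and> before w m b \<or> before w x m \<and> before w b m"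
        proof cases
          case 1
          then show ?thesis using first[of m] before_total[of b w m] b m by auto
        next
          case 2
          then show ?thesis using tr[of m x b] b by auto
        next
          case 3
          then show ?thesis using tr[of z x b] b zx by auto
        next
          case 4
          then show ?thesis using mid[of m] m bm[of m] xm[of m] by auto
        qed
      qed
      moreover have "separated_by w x b z y"
        unfolding separated_by_def using b less.prems zx tr[of z x b] bm[of y] xm[of y] sep by auto
      ultimately have "violation w x b" unfolding violation_def using b less.prems by blast
      moreover have "b - x < d - a" using b sep by linarith
      ultimately show ?thesis by blast
    qed
  qed
qed

text \<open>Comparing \<open>x\<close> with \<open>y'\<close> yields either
  \<open>x < y' < x'\<close>, a right letter between two left ones, or \<open>y' < x < y\<close>, a
  left letter between two right ones. Reversing the word turns the second case into the
  first.\<close>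

lemma smaller_violation_if_mixed:
  assumes "distinct w" "unseparated w a d"
    and "separated_by w a d x y" "x < y" "separated_by w a d x' y'" "y' < x'"
  shows "\<exists>a' d'. violation w a' d' \<and> d' - a' < d - a"
proof -
  have "x \<noteq> y'" using before_asym[OF assms(1), of x a] assms(3,5) by (auto simp: separated_by_def)
  then consider "x < y'" | "y' < x" by linarith
  then show ?thesis
  proof cases
    case 1
    have "separated_by w a d x y'" using assms(3,5) by (auto simp: separated_by_def)
    then show ?thesis
      using smaller_violation_if_alternating[OF assms(1,2)] 1 assms(5,6) by blast
  next
    case 2
    have "separated_by (rev w) a d y' x" "separated_by (rev w) a d y x"
      using assms(3,5) by (auto simp: before_rev separated_by_def)
    then show ?thesis
      using smaller_violation_if_alternating[of "rev w" a d y' x y] 2 assms(1,2,4)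
      by (simp add: unseparated_rev violation_rev)
  qed
qed

section \<open>Existence by removing violations\<close>

lemma swaps_move:
  assumes "x \<in> set u" "y \<in> set v"
    and "\<And>p. p \<in> set m \<Longrightarrow> min p q < x \<and> x < max p q \<and> min p q < y \<and> y < max p q"
  shows "swap\<^sup>*\<^sup>* (u @ q # m @ v) (u @ m @ q # v)"
  using assms(1,3)
proof (induction m arbitrary: u)
  case (Cons p m)
  have "swap (u @ [q, p] @ (m @ v)) (u @ [p, q] @ (m @ v))"
    using Cons.prems(1) Cons.prems(2)[of p] assms(2)
    by (intro swap.intros[of x _ y]) (auto simp: min.commute max.commute)
  moreover have "swap\<^sup>*\<^sup>* ((u @ [p]) @ q # m @ v) ((u @ [p]) @ m @ q # v)"
    using Cons.prems by (intro Cons.IH) auto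
  ultimately show ?case by (simp add: converse_rtranclp_into_rtranclp)
qed simp

text \<open>A stable partition in the manner of insertion sort: once the tail is partitioned, a
  leading letter without \<open>P\<close> moves past the letters with \<open>P\<close>. Every
  exchange is licensed by the same \<open>x\<close> and \<open>y\<close>.\<close>

lemma swaps_partition:
  assumes "x \<in> set u" "y \<in> set v"
    and "\<And>p q. p \<in> set m \<Longrightarrow> q \<in> set m \<Longrightarrow> P p \<Longrightarrow> \<not> P q \<Longrightarrow>
      min p q < x \<and> x < max p q \<and> min p q < y \<and> y < max p q"
  shows "swap\<^sup>*\<^sup>* (u @ m @ v) (u @ filter P m @ filter (\<lambda>z. \<not> P z) m @ v)"
  using assms(1,3)
proof (induction m arbitrary: u)
  case (Cons z m)
  have IH: "swap\<^sup>*\<^sup>* ((u @ [z]) @ m @ v) ((u @ [z]) @ filter P m @ filter (\<lambda>z. \<not> P z) m @ v)"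
    using Cons.prems by (intro Cons.IH) auto
  show ?case
  proof (cases "P z")
    case True
    then show ?thesis using IH by simp
  next
    case False
    have "swap\<^sup>*\<^sup>* (u @ z # filter P m @ (filter (\<lambda>z. \<not> P z) m @ v))
        (u @ filter P m @ z # (filter (\<lambda>z. \<not> P z) m @ v))"
      using Cons.prems False assms(2) by (intro swaps_move[of x _ y]) auto
    then show ?thesis using IH False by simp
  qed
qed simp

text \<open>The factor from \<open>a\<close> to \<open>d\<close> has only letters
  \<open>\<le> a\<close> or \<open>\<ge> d\<close>. Partitioning it stably into these two sides
  reverses \<open>a\<close> and \<open>d\<close>, while letters on the same side keep their
  order.\<close>

lemma flip_unseparated:
  assumes "distinct w" "unseparated w a d" "separated_by w a d x y"
  obtains w' where "swap\<^sup>*\<^sup>* w w'"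
    "before w a d \<and> before w' d a \<or> before w d a \<and> before w' a d"
    "\<And>b c. \<not> (b \<le> a \<and> d \<le> c) \<Longrightarrow> \<not> (c \<le> a \<and> d \<le> b) \<Longrightarrow> before w' b c \<longleftrightarrow> before w b c"
proof -
  have ad: "a < x" "x < d" "a < y" "y < d" "a \<in> set w" "d \<in> set w"
    using assms(3) separated_by_in_set[OF assms(3)] by (auto simp: separated_by_def)
  define s t where "s = (if before w a d then a else d)" and "t = (if before w a d then d else a)"
  have st: "before w s t" "{s, t} = {a, d}"
    using before_total[of a w d] ad unfolding s_def t_def by auto
  obtain u m v where w: "w = u @ (s # m @ [t]) @ v" and xy: "x \<in> set u" "y \<in> set v"
    and block: "\<And>z. z \<in> set (s # m @ [t]) \<Longrightarrow> z \<le> a \<or> d \<le> z"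
    by (rule unseparated_split[OF assms st]) (rule that)
  define M where "M = s # m @ [t]"
  \<comment> \<open>\<open>P\<close> selects the side of \<open>t\<close>, the later of the two
    letters, so this side is moved to the front.\<close>
  define P where "P = (\<lambda>z. z \<le> a \<longleftrightarrow> t = a)"
  define w' where "w' = u @ filter P M @ filter (\<lambda>z. \<not> P z) M @ v"
  have M: "s \<in> set M" "t \<in> set M" "P t" "\<not> P s"
    using st ad unfolding M_def P_def by (auto simp: doubleton_eq_iff)
  show thesis
  proof
    show "swap\<^sup>*\<^sup>* w w'"
      unfolding w w'_def M_def[symmetric]
    proof (rule swaps_partition[of x u y, OF xy])
      fix p q assume "p \<in> set M" "q \<in> set M" "P p" "\<not> P q"
      then have "p \<le> a \<and> d \<le> q \<or> q \<le> a \<and> d \<le> p"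
        using block[of p] block[of q] ad unfolding P_def M_def[symmetric] by auto
      then show "min p q < x \<and> x < max p q \<and> min p q < y \<and> y < max p q" using ad by auto
    qed
    have "before w' t s"
      using M by (simp add: w'_def before_append)
    then show "before w a d \<and> before w' d a \<or> before w d a \<and> before w' a d"
      using st by (auto simp: doubleton_eq_iff)
    fix b c assume bc: "\<not> (b \<le> a \<and> d \<le> c)" "\<not> (c \<le> a \<and> d \<le> b)"
    have "P b = P c" if "b \<in> set M" "c \<in> set M"
      using bc that block[of b] block[of c] ad unfolding P_def M_def[symmetric] by auto
    then show "before w' b c \<longleftrightarrow> before w b c"
      unfolding w w'_def M_def[symmetric] before_append before_filter
      using before_in_set[of M b c] by auto
  qed
qed

text \<open>Both notions compare an end of the interval with an inner letter only, never
  \<open>a\<close> with \<open>d\<close>; this is why that pair may be exempted.\<close>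

lemma separation_cong:
  assumes "set w = set w'"
    and "\<And>b c. a \<le> b \<Longrightarrow> b \<le> d \<Longrightarrow> a \<le> c \<Longrightarrow> c \<le> d \<Longrightarrow> {b, c} \<noteq> {a, d} \<Longrightarrow>
      before w b c \<longleftrightarrow> before w' b c"
  shows "unseparated w a d \<longleftrightarrow> unseparated w' a d"
    and "separated_by w a d x y \<longleftrightarrow> separated_by w' a d x y"
proof -
  have mid: "before w m a = before w' m a" "before w m d = before w' m d"
    "before w a m = before w' a m" "before w d m = before w' d m" if "a < m" "m < d" for m
    using that assms(2)[of m a] assms(2)[of m d] assms(2)[of a m] assms(2)[of d m]
    by (auto simp: doubleton_eq_iff)
  then show "unseparated w a d \<longleftrightarrow> unseparated w' a d"
    unfolding unseparated_def assms(1) by (simp cong: ball_cong conj_cong imp_cong)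
  show "separated_by w a d x y \<longleftrightarrow> separated_by w' a d x y"
    unfolding separated_by_def using mid by auto
qed

lemma flip_minimal_violation:
  assumes dist: "distinct w" and viol: "violation w a d"
    and minimal: "\<And>a' d'. violation w a' d' \<Longrightarrow> d - a \<le> d' - a'"
  obtains w' where "swap\<^sup>*\<^sup>* w w'" "\<not> violation w' a d"
    "\<And>a' d'. violation w' a' d' \<Longrightarrow> d' - a' \<le> d - a \<Longrightarrow> violation w a' d'"
proof -
  obtain x y where xy: "separated_by w a d x y"
    and or: "before w a d \<and> y < x \<or> before w d a \<and> x < y" and un: "unseparated w a d"
    using viol unfolding violation_def by blast
  have "a < d" using xy by (auto simp: separated_by_def)
  obtain w' where w': "swap\<^sup>*\<^sup>* w w'"
    and flipped: "before w a d \<and> before w' d a \<or> before w d a \<and> before w' a d"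
    and agree: "\<And>b c. \<not> (b \<le> a \<and> d \<le> c) \<Longrightarrow> \<not> (c \<le> a \<and> d \<le> b) \<Longrightarrow>
      before w' b c \<longleftrightarrow> before w b c"
    by (rule flip_unseparated[OF dist un xy]) (rule that)
  have ms: "set w' = set w" "distinct w'"
    using swap_rtranclp_set[OF w'] swap_rtranclp_distinct[OF w' dist] by auto
  show thesis
  proof
    show "swap\<^sup>*\<^sup>* w w'" by (rule w')
    show not_viol: "\<not> violation w' a d"
    proof
      assume "violation w' a d"
      then obtain x' y' where xy': "separated_by w' a d x' y'"
        and or': "before w' a d \<and> y' < x' \<or> before w' d a \<and> x' < y'"
        unfolding violation_def by blast
      have "before w' b c \<longleftrightarrow> before w b c"
        if "a \<le> b" "b \<le> d" "a \<le> c" "c \<le> d" "{b, c} \<noteq> {a, d}" for b c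
        using that by (intro agree) (auto simp: doubleton_eq_iff)
      then have "separated_by w' a d x' y' \<longleftrightarrow> separated_by w a d x' y'"
        by (rule separation_cong(2)[OF ms(1)])
      then have "separated_by w a d x' y'" using xy' by blast
      \<comment> \<open>With \<open>a\<close> and \<open>d\<close> reversed, a violation needs
        witnesses in the opposite order.\<close>
      moreover have "x < y \<and> y' < x' \<or> y < x \<and> x' < y'"
        using or or' flipped before_asym[OF dist, of a d] before_asym[OF ms(2), of a d] by auto
      ultimately obtain a' d' where "violation w a' d'" "d' - a' < d - a"
        using smaller_violation_if_mixed[OF dist un] xy by blast
      then show False using minimal by fastforce
    qed
    fix a' d' assume viol': "violation w' a' d'" and le: "d' - a' \<le> d - a"
    have "a' < d'" using viol' by (auto simp: violation_def separated_by_def)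
    moreover have "(a', d') \<noteq> (a, d)" using not_viol viol' by auto
    \<comment> \<open>An interval that contains \<open>[a, d]\<close> and is no wider equals it, so
      the flip leaves all pairs in \<open>[a', d']\<close> alone.\<close>
    ultimately have "\<not> (a' \<le> a \<and> d \<le> d')" using le \<open>a < d\<close> by auto
    then have same: "before w' b c \<longleftrightarrow> before w b c" if "a' \<le> b" "b \<le> d'" "a' \<le> c" "c \<le> d'" for b c
      using that by (intro agree) auto
    have "unseparated w' a' d' \<longleftrightarrow> unseparated w a' d'"
      by (rule separation_cong(1)[OF ms(1)]) (rule same)
    moreover have "separated_by w' a' d' x y \<longleftrightarrow> separated_by w a' d' x y" for x y
      by (rule separation_cong(2)[OF ms(1)]) (rule same)
    ultimately show "violation w a' d'"
      using viol' same[of a' d'] same[of d' a'] \<open>a' < d'\<close> unfolding violation_def by auto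
  qed
qed

text \<open>Induction on the number of violations of width \<open>k\<close>: as none is narrower,
  flipping one removes it and creates none of width at most \<open>k\<close>.\<close>

lemma remove_violations_of_width:
  assumes "distinct w" "\<And>a d. violation w a d \<Longrightarrow> k \<le> d - a"
  shows "\<exists>w'. swap\<^sup>*\<^sup>* w w' \<and> (\<forall>a d. violation w' a d \<longrightarrow> Suc k \<le> d - a)"
  using assms
proof (induction "card {(a, d). violation w a d \<and> d - a = k}" arbitrary: w rule: less_induct)
  case less
  let ?V = "\<lambda>w. {(a, d). violation w a d \<and> d - a = k}"
  show ?case
  proof (cases "\<exists>a d. violation w a d \<and> d - a = k")
    case True
    then obtain a d where ad: "violation w a d" "d - a = k" by blast
    have minimal: "d - a \<le> d' - a'" if "violation w a' d'" for a' d'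
      using less.prems(2) that ad(2) by simp
    obtain w' where w': "swap\<^sup>*\<^sup>* w w'" "\<not> violation w' a d"
      and old: "\<And>a' d'. violation w' a' d' \<Longrightarrow> d' - a' \<le> d - a \<Longrightarrow> violation w a' d'"
      by (rule flip_minimal_violation[OF less.prems(1) ad(1) minimal]) (assumption, rule that)
    have "?V w \<subseteq> set w \<times> set w"
      by (auto simp: violation_def dest: separated_by_in_set)
    then have "finite (?V w)" by (rule finite_subset) simp
    moreover have "?V w' \<subset> ?V w"
    proof
      show "?V w' \<subseteq> ?V w" using old ad by auto
      have "(a, d) \<in> ?V w" "(a, d) \<notin> ?V w'" using ad w'(2) by auto
      then show "?V w' \<noteq> ?V w" by blast
    qed
    ultimately have "card (?V w') < card (?V w)" by (rule psubset_card_mono)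
    moreover have "distinct w'"
      using swap_rtranclp_distinct[OF w'(1) less.prems(1)] .
    moreover have "k \<le> d' - a'" if "violation w' a' d'" for a' d'
      using old[OF that] less.prems(2)[of a' d'] ad(2) by linarith
    ultimately obtain w'' where "swap\<^sup>*\<^sup>* w' w''" "\<forall>a d. violation w'' a d \<longrightarrow> Suc k \<le> d - a"
      using less.hyps by blast
    then show ?thesis using w'(1) rtranclp_trans[of swap w w' w''] by blast
  next
    case False
    then have "Suc k \<le> d - a" if "violation w a d" for a d
      using less.prems(2)[OF that] that by (metis Suc_leI le_neq_implies_less)
    then show ?thesis by blast
  qed
qed

lemma exists_without_violation:
  assumes "distinct w"
  shows "\<exists>w'. swap\<^sup>*\<^sup>* w w' \<and> (\<nexists>a d. violation w' a d)"
proof -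
  have "\<exists>w'. swap\<^sup>*\<^sup>* w w' \<and> (\<forall>a d. violation w' a d \<longrightarrow> k \<le> d - a)" for k
  proof (induction k)
    case (Suc k)
    then obtain v where v: "swap\<^sup>*\<^sup>* w v" "\<And>a d. violation v a d \<Longrightarrow> k \<le> d - a" by blast
    have "distinct v"
      using swap_rtranclp_distinct[OF v(1) assms] .
    then obtain w' where "swap\<^sup>*\<^sup>* v w'" "\<forall>a d. violation w' a d \<longrightarrow> Suc k \<le> d - a"
      using remove_violations_of_width v(2) by blast
    then show ?case using v(1) rtranclp_trans[of swap w v w'] by blast
  qed auto
  \<comment> \<open>\<open>sum_list w\<close> is a crude upper bound for every letter, hence for
    every width.\<close>
  then obtain w' where w': "swap\<^sup>*\<^sup>* w w'"
    "\<And>a d. violation w' a d \<Longrightarrow> Suc (sum_list w) \<le> d - a" by blast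
  have "\<not> violation w' a d" for a d
  proof
    assume viol: "violation w' a d"
    then have "d \<in> set w'"
      by (auto simp: violation_def dest: separated_by_in_set)
    then have "d \<in> set w" using swap_rtranclp_set[OF w'(1)] by simp
    then have "d \<le> sum_list w" by (intro member_le_sum_list) auto
    then show False using w'(2)[OF viol] by simp
  qed
  then show ?thesis using w'(1) by blast
qed

section \<open>Standardization and Baxter permutations\<close>

lemma in_permutations_of_set_iff: "s \<in> permutations_of_set A \<longleftrightarrow> set s = A \<and> distinct s"
  by (auto simp: permutations_of_set_def)

lemma length_perms: "s \<in> perms n \<Longrightarrow> length s = n"
  using distinct_card[of s] by (simp add: in_permutations_of_set_iff)

text \<open>The bounded quantifiers can be unfolded by \<open>All_less_Suc\<close> for words of
  length four.\<close>

lemma inversions_eq_iff: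
  assumes "length u = length s"
  shows "inversions u = inversions s \<longleftrightarrow>
    (\<forall>j<length u. \<forall>i<j. u ! j < u ! i \<longleftrightarrow> s ! j < s ! i)"
  using assms by (auto simp: inversions_def set_eq_iff)

text \<open>An entry of a permutation equals its rank among the entries, and ranks can be compared
  through inversions.\<close>

lemma nth_perms:
  assumes "s \<in> perms n" "i < n"
  shows "s ! i = card {j \<in> {..<n}. s ! j \<le> s ! i}"
proof -
  have s: "set s = {1..n}" "distinct s" "length s = n"
    using assms(1) length_perms by (auto simp: in_permutations_of_set_iff)
  have "inj_on ((!) s) {j \<in> {..<n}. s ! j \<le> s ! i}"
    using s by (auto simp: inj_on_def nth_eq_iff_index_eq)
  then have "card {j \<in> {..<n}. s ! j \<le> s ! i} = card ((!) s ` {j \<in> {..<n}. s ! j \<le> s ! i})"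
    by (simp add: card_image)
  also have "(!) s ` {j \<in> {..<n}. s ! j \<le> s ! i} = {y \<in> set s. y \<le> s ! i}"
    using s(3) by (auto simp: set_conv_nth)
  also have "\<dots> = {1..s ! i}"
    using s assms(2) nth_mem[of i s] by auto
  finally show ?thesis by simp
qed

lemma inversions_inj_on_perms:
  assumes "s \<in> perms n" "t \<in> perms n" "inversions s = inversions t"
  shows "s = t"
proof (rule nth_equalityI)
  have len: "length s = n" "length t = n" and dist: "distinct s" "distinct t"
    using assms length_perms by (auto simp: in_permutations_of_set_iff)
  then show "length s = length t" by simp
  fix i assume i: "i < length s"
  have less_iff: "s ! j < s ! k \<longleftrightarrow> t ! j < t ! k" if "k < j" "j < n" for j k
    using assms(3) that len inversions_eq_iff[of s t] by auto
  have "s ! j \<le> s ! i \<longleftrightarrow> t ! j \<le> t ! i" if "j < n" for j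
  proof (cases i j rule: linorder_cases)
    case less
    then show ?thesis
      using less_iff[of i j] that i len dist
        nth_eq_iff_index_eq[of s i j] nth_eq_iff_index_eq[of t i j] by auto
  next
    case greater
    then show ?thesis using less_iff[of j i] i len by auto
  qed simp
  then have "{j \<in> {..<n}. s ! j \<le> s ! i} = {j \<in> {..<n}. t ! j \<le> t ! i}" by auto
  then show "s ! i = t ! i" using nth_perms[OF assms(1), of i] nth_perms[OF assms(2), of i] i len by simp
qed

text \<open>Replacing each letter by its rank \<open>r\<close> in the word keeps all comparisons and
  maps onto an initial segment.\<close>

lemma exists_standardization:
  assumes "distinct u"
  shows "\<exists>s \<in> perms (length u). inversions s = inversions u"
proof -
  define r where "r = (\<lambda>x. card {y \<in> set u. y \<le> x})"
  have mono: "r x < r y" if "x < y" "y \<in> set u" for x y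
  proof -
    have "y \<in> {z \<in> set u. z \<le> y} - {z \<in> set u. z \<le> x}" using that by auto
    moreover have "{z \<in> set u. z \<le> x} \<subseteq> {z \<in> set u. z \<le> y}" using that by auto
    ultimately have "{z \<in> set u. z \<le> x} \<subset> {z \<in> set u. z \<le> y}" by blast
    then show ?thesis unfolding r_def by (intro psubset_card_mono) auto
  qed
  have mono_iff: "r x < r y \<longleftrightarrow> x < y" if "x \<in> set u" "y \<in> set u" for x y
    using mono[of x y] mono[of y x] that by (cases x y rule: linorder_cases) auto
  have "inj_on r (set u)"
    by (auto simp: inj_on_def) (metis mono_iff linorder_neq_iff)
  moreover have "r ` set u \<subseteq> {1..length u}"
  proof
    fix z assume "z \<in> r ` set u"
    then obtain x where x: "x \<in> set u" "z = r x" by blast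
    have "0 < r x" unfolding r_def using x by (auto simp: card_gt_0_iff)
    moreover have "r x \<le> card (set u)" unfolding r_def by (intro card_mono) auto
    ultimately show "z \<in> {1..length u}" using x card_length[of u] by auto
  qed
  ultimately have "r ` set u = {1..length u}"
    using distinct_card[OF assms] by (intro card_subset_eq) (auto simp: card_image)
  then have "map r u \<in> perms (length u)"
    using \<open>inj_on r (set u)\<close> assms by (simp add: in_permutations_of_set_iff distinct_map)
  moreover have "inversions (map r u) = inversions u"
    by (subst inversions_eq_iff) (auto simp: mono_iff)
  ultimately show ?thesis by blast
qed

text \<open>Existence and uniqueness together resolve the definite description in
  \<open>std\<close>.\<close>

lemma std_eq_iff:
  assumes "distinct u" "s \<in> perms (length u)"
  shows "std u = s \<longleftrightarrow> inversions u = inversions s"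
proof -
  obtain t where t: "t \<in> perms (length u)" "inversions t = inversions u"
    using exists_standardization[OF assms(1)] by blast
  have "std u = t"
    unfolding std_def using t inversions_inj_on_perms by (intro the_equality) auto
  then show ?thesis using t assms(2) inversions_inj_on_perms by metis
qed

lemma std_length_4:
  assumes "distinct [x, p, q, y]"
  shows "std [x, p, q, y] = [2, 4, 1, 3] \<longleftrightarrow> q < x \<and> x < y \<and> y < p"
    and "std [x, p, q, y] = [3, 1, 4, 2] \<longleftrightarrow> p < y \<and> y < x \<and> x < q"
proof -
  have "[2, 4, 1, 3] \<in> perms (length [x, p, q, y])" "[3, 1, 4, 2] \<in> perms (length [x, p, q, y])"
    by (auto simp: in_permutations_of_set_iff)
  note eq = this[THEN std_eq_iff[OF assms]]
  show "std [x, p, q, y] = [2, 4, 1, 3] \<longleftrightarrow> q < x \<and> x < y \<and> y < p"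
    and "std [x, p, q, y] = [3, 1, 4, 2] \<longleftrightarrow> p < y \<and> y < x \<and> x < q"
    unfolding eq using assms by (auto simp: inversions_eq_iff All_less_Suc)
qed

text \<open>Passes from positions to factors: \<open>p\<close>, \<open>q\<close> sit at positions
  \<open>j\<close> and \<open>Suc j\<close>, \<open>x\<close> in the prefix before them and
  \<open>y\<close> in the suffix after them.\<close>

lemma baxter_permutation_iff:
  assumes "\<sigma> \<in> perms n"
  shows "baxter_permutation \<sigma> \<longleftrightarrow> \<not> adjacent_pattern \<sigma>"
proof -
  have dist: "distinct \<sigma>" and len: "length \<sigma> = n"
    using assms length_perms by (auto simp: in_permutations_of_set_iff)
  have pattern: "std [\<sigma> ! i, \<sigma> ! j, \<sigma> ! Suc j, \<sigma> ! l] \<in> {[2, 4, 1, 3], [3, 1, 4, 2]} \<longleftrightarrow>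
      \<sigma> ! Suc j < \<sigma> ! i \<and> \<sigma> ! i < \<sigma> ! l \<and> \<sigma> ! l < \<sigma> ! j \<or>
      \<sigma> ! j < \<sigma> ! l \<and> \<sigma> ! l < \<sigma> ! i \<and> \<sigma> ! i < \<sigma> ! Suc j"
    if "i < j" "Suc j < l" "l < length \<sigma>" for i j l
  proof -
    have "distinct [\<sigma> ! i, \<sigma> ! j, \<sigma> ! Suc j, \<sigma> ! l]"
      using that dist by (auto simp: nth_eq_iff_index_eq)
    from std_length_4[OF this] show ?thesis by auto
  qed
  show ?thesis
  proof
    assume bax: "baxter_permutation \<sigma>"
    show "\<not> adjacent_pattern \<sigma>"
    proof
      assume "adjacent_pattern \<sigma>"
      then obtain u x p q v y where w: "\<sigma> = u @ [p, q] @ v" "x \<in> set u" "y \<in> set v"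
        and or: "p < y \<and> y < x \<and> x < q \<or> q < x \<and> x < y \<and> y < p"
        unfolding adjacent_pattern_def by blast
      obtain i where i: "i < length u" "u ! i = x" using w(2) by (auto simp: in_set_conv_nth)
      obtain l where l: "l < length v" "v ! l = y" using w(3) by (auto simp: in_set_conv_nth)
      have nth: "\<sigma> ! i = x" "\<sigma> ! length u = p" "\<sigma> ! Suc (length u) = q"
        "\<sigma> ! (Suc (Suc (length u)) + l) = y"
        using w(1) i l by (auto simp: nth_append)
      have ord: "i < length u" "Suc (length u) < Suc (Suc (length u)) + l"
        "Suc (Suc (length u)) + l < length \<sigma>"
        using i l w(1) by auto
      then have "std [\<sigma> ! i, \<sigma> ! length u, \<sigma> ! Suc (length u), \<sigma> ! (Suc (Suc (length u)) + l)]
          \<notin> {[2, 4, 1, 3], [3, 1, 4, 2]}"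
        using bax unfolding baxter_permutation_def by blast
      then show False
        using or unfolding pattern[OF ord] unfolding nth by blast
    qed
  next
    assume no: "\<not> adjacent_pattern \<sigma>"
    have "std [\<sigma> ! i, \<sigma> ! j, \<sigma> ! Suc j, \<sigma> ! l] \<notin> {[2, 4, 1, 3], [3, 1, 4, 2]}"
      if ijl: "i < j" "Suc j < l" "l < length \<sigma>" for i j l
    proof
      let ?u = "take j \<sigma>" and ?v = "drop (Suc (Suc j)) \<sigma>"
      assume "std [\<sigma> ! i, \<sigma> ! j, \<sigma> ! Suc j, \<sigma> ! l] \<in> {[2, 4, 1, 3], [3, 1, 4, 2]}"
      then have or: "\<sigma> ! j < \<sigma> ! l \<and> \<sigma> ! l < \<sigma> ! i \<and> \<sigma> ! i < \<sigma> ! Suc j \<or>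
          \<sigma> ! Suc j < \<sigma> ! i \<and> \<sigma> ! i < \<sigma> ! l \<and> \<sigma> ! l < \<sigma> ! j"
        using pattern[OF ijl] by blast
      have "\<sigma> = ?u @ [\<sigma> ! j, \<sigma> ! Suc j] @ ?v"
        using ijl by (simp add: Cons_nth_drop_Suc)
      moreover have "\<sigma> ! i \<in> set ?u" using ijl by (auto simp: in_set_conv_nth intro!: exI[of _ i])
      moreover have "\<sigma> ! l \<in> set ?v"
      proof -
        obtain k where "l = Suc (Suc j) + k" using ijl by (metis Suc_leI le_Suc_ex)
        then show ?thesis using ijl by (auto simp: in_set_conv_nth intro!: exI[of _ k])
      qed
      ultimately have "adjacent_pattern \<sigma>" unfolding adjacent_pattern_def using or by blast
      then show False using no by blast
    qed
    then show "baxter_permutation \<sigma>"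
      unfolding baxter_permutation_def using assms len by auto
  qed
qed

lemma baxter_permutation_iff_no_violation:
  assumes "\<sigma> \<in> perms n"
  shows "baxter_permutation \<sigma> \<longleftrightarrow> (\<nexists>a d. violation \<sigma> a d)"
proof -
  have "distinct \<sigma>" using assms by (simp add: in_permutations_of_set_iff)
  then show ?thesis
    unfolding baxter_permutation_iff[OF assms]
    using violation_imp_adjacent_pattern[of \<sigma>] adjacent_pattern_imp_violation[of \<sigma>] by blast
qed

theorem theorem4p14:
  fixes n :: nat
  shows "\<forall>C \<in> perms n // baxter_cong_perms n. \<exists>!\<sigma>. \<sigma> \<in> C \<and> baxter_permutation \<sigma>"
proof
  fix C assume "C \<in> perms n // baxter_cong_perms n"
  then obtain w where w: "w \<in> perms n" and C: "C = baxter_cong_perms n `` {w}"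
    by (auto elim: quotientE)
  have dist: "distinct w" using w by (simp add: in_permutations_of_set_iff)
  obtain \<tau> where \<tau>: "swap\<^sup>*\<^sup>* w \<tau>" "\<nexists>a d. violation \<tau> a d"
    using exists_without_violation[OF dist] by blast
  have "\<tau> \<in> perms n"
    using swap_rtranclp_set[OF \<tau>(1)] swap_rtranclp_distinct[OF \<tau>(1) dist] w
    by (simp add: in_permutations_of_set_iff)
  moreover have "(w, \<tau>) \<in> baxter_cong"
    using swaps_imp_baxter_cong[OF \<tau>(1)] w perms_subset_words by auto
  ultimately have "\<tau> \<in> C" "baxter_permutation \<tau>"
    using w \<tau>(2) C baxter_permutation_iff_no_violation by (auto simp: baxter_cong_perms_def)
  moreover have "\<sigma> = \<tau>" if "\<sigma> \<in> C" "baxter_permutation \<sigma>" for \<sigma>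
  proof -
    have \<sigma>: "\<sigma> \<in> perms n" "(w, \<sigma>) \<in> baxter_cong"
      using that C by (auto simp: baxter_cong_perms_def)
    \<comment> \<open>Going through the representative \<open>w\<close> connects the two Baxter
      permutations directly, so that uniqueness applies to a single sequence of exchanges.\<close>
    have "(\<sigma>, \<tau>) \<in> baxter_cong"
      using \<sigma>(2) \<open>(w, \<tau>) \<in> baxter_cong\<close> by (blast intro: baxter_cong.sym baxter_cong.trans)
    moreover have "distinct \<sigma>" using \<sigma>(1) by (simp add: in_permutations_of_set_iff)
    ultimately have "swap\<^sup>*\<^sup>* \<sigma> \<tau>" by (rule baxter_cong_imp_swaps)
    then show ?thesis
      using unique_without_violation \<open>distinct \<sigma>\<close> \<tau>(2) that(2) \<sigma>(1)
        baxter_permutation_iff_no_violation by blast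
  qed
  ultimately show "\<exists>!\<sigma>. \<sigma> \<in> C \<and> baxter_permutation \<sigma>" by blast
qed

end
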